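(* Let $B, T$ be integers with $T \ge B \ge 1$, let $\alpha \ge 2$ be an integer, and set $(B_1,T_1) = (B,T)$ and $B_2 = \alpha B$. Consider all two-receiver multicast streaming codes (as defined in the context) of rate $R = \frac{T}{T+B}$ that are feasible for $\{(B_1,T_1),(B_2,T_2)\}$ for some integer delay $T_2 \ge 0$. Then the minimum possible value of the delay $T_2$ at receiver 2 over all such codes is $$T_2^\star = \alpha T + B .$$ That is: (i) every code of rate $R = \frac{T}{T+B}$ that is feasible for $\{(B,T),(\alpha B,T_2)\}$ satisfies $T_2 \ge \alpha T + B$; and (ii) there exists a code of rate $\frac{T}{T+B}$ that is feasible for $\{(B,T),(\alpha B,\alpha T+B)\}$.
   Context: **Source and encoder.** The source is an i.i.d. sequence $\{s[t]\}_{t\ge 0}$, each symbol drawn from a distribution $p_{\mathsf{s}}$ on $\mathbb{F}_Q^T$ with entropy $H(\mathsf{s})>0$, where $\mathbb{F}_Q$ is a finite field. A multicast streaming code is a choice of $Q$, $p_{\mathsf{s}}$ and a sequence of deterministic causal encoding functions $f_t$ with values in a finite channel alphabet, producing channel symbols $x[t] = f_t(s[0],\dots,s[t])$ for $t \ge 0$. **Channels.** Receiver $i\in\{1,2\}$ observes the output of a burst-erasure channel that introduces one erasure burst of length $B_i$ starting at an arbitrary time $j_i \ge 0$: $$y_i[t] = \begin{cases} \star & t \in [j_i,\, j_i+B_i-1],\\ x[t] & \text{otherwise,}\end{cases}$$ where $\star$ is an erasure symbol outside the channel alphabet. **Feasibility.** For nonnegative integers $T_1,T_2$, the code is feasible for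 $\{(B_1,T_1),(B_2,T_2)\}$ if for each $i\in\{1,2\}$ there are decoding functions $\gamma_{it}$, $t\ge 0$ (not depending on $j_i$), such that for every burst starting time $j_i\ge 0$ and every $t \ge 0$, the estimate $\hat{s}_i[t] = \gamma_{it}(y_i[0],y_i[1],\dots,y_i[t+T_i])$ satisfies $\Pr(\hat{s}_i[t] \ne s[t]) = 0$. That is, receiver $i$ recovers each source symbol with delay at most $T_i$. The same encoder is used for both receivers. **Rate.** The rate of the code is $R = H(\mathsf{s})/H(\mathsf{x})$, where $H(\mathsf{s})$ is the entropy of a source symbol and $H(\mathsf{x})$ is the marginal entropy of a channel symbol. When the marginal entropy $H(x[t])$ varies with $t$, take $H(\mathsf{x}) = \sup_{t\ge 0} H(x[t])$. *)

theory Defs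
  imports "HOL-Probability.Probability" "HOL-Algebra.Ring"
begin

record ('q, 'x) streaming_code =
  code_field :: "'q ring"
  source_dist :: "'q list pmf"
  channel_alphabet :: "'x set"
  encoder :: "nat \<Rightarrow> 'q list list \<Rightarrow> 'x"

text \<open>The vector space \<open>F\<^sup>n\<close> over the code's field, vectors being lists of length \<open>n\<close>.\<close>

definition source_alphabet :: "nat \<Rightarrow> ('q, 'x, 'm) streaming_code_scheme \<Rightarrow> 'q list set" where
  "source_alphabet n C = {v. set v \<subseteq> carrier (code_field C) \<and> length v = n}"

text \<open>
  The canonical space of i.i.d. source sequences; the source symbol at time \<open>t\<close> is the
  coordinate \<open>\<omega> t\<close>. A pmf lives on the whole type, so it is restricted to the source alphabet:
  sample paths then take only genuine source values, and since that alphabet is finite, every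
  event that depends on finitely many coordinates is measurable.
\<close>

definition source_space ::
    "nat \<Rightarrow> ('q, 'x, 'm) streaming_code_scheme \<Rightarrow> (nat \<Rightarrow> 'q list) measure" where
  "source_space n C =
     Pi\<^sub>M UNIV (\<lambda>_. restrict_space (measure_pmf (source_dist C)) (source_alphabet n C))"

definition channel_symbol ::
    "('q, 'x, 'm) streaming_code_scheme \<Rightarrow> nat \<Rightarrow> (nat \<Rightarrow> 'q list) \<Rightarrow> 'x" where
  "channel_symbol C t \<omega> = encoder C t (map \<omega> [0..<Suc t])"

text \<open>Shannon entropy in bits of a discrete random variable, the library's \<open>\<H>(X)\<close>.\<close>

definition rv_entropy :: "'a measure \<Rightarrow> ('a \<Rightarrow> 'b) \<Rightarrow> real" where
  "rv_entropy M X = prob_space.entropy M 2 (count_space (X ` space M)) X"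

definition source_entropy :: "nat \<Rightarrow> ('q, 'x, 'm) streaming_code_scheme \<Rightarrow> real" where
  "source_entropy n C = rv_entropy (source_space n C) (\<lambda>\<omega>. \<omega> 0)"

text \<open>
  For a streaming code the supremum is over a set bounded by the logarithm of the size of the
  channel alphabet.
\<close>

definition channel_entropy :: "nat \<Rightarrow> ('q, 'x, 'm) streaming_code_scheme \<Rightarrow> real" where
  "channel_entropy n C = (SUP t. rv_entropy (source_space n C) (channel_symbol C t))"

definition rate :: "nat \<Rightarrow> ('q, 'x, 'm) streaming_code_scheme \<Rightarrow> real" where
  "rate n C = source_entropy n C / channel_entropy n C"

definition is_streaming_code :: "nat \<Rightarrow> ('q, 'x, 'm) streaming_code_scheme \<Rightarrow> bool" where
  "is_streaming_code n C \<longleftrightarrow>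
     field (code_field C) \<and> finite (carrier (code_field C)) \<and>
     set_pmf (source_dist C) \<subseteq> source_alphabet n C \<and>
     0 < source_entropy n C \<and>
     finite (channel_alphabet C) \<and>
     (\<forall>t w. length w = Suc t \<longrightarrow> set w \<subseteq> source_alphabet n C \<longrightarrow>
        encoder C t w \<in> channel_alphabet C)"

text \<open>Erasures are \<open>None\<close>; the burst has length \<open>b\<close> and starts at time \<open>j\<close>.\<close>

definition received ::
    "('q, 'x, 'm) streaming_code_scheme \<Rightarrow> nat \<Rightarrow> nat \<Rightarrow> nat \<Rightarrow> (nat \<Rightarrow> 'q list) \<Rightarrow> 'x option" where
  "received C b j t \<omega> = (if j \<le> t \<and> t < j + b then None else Some (channel_symbol C t \<omega>))"

text \<open>
  \<open>R\<close> is the set of the receivers' pairs (burst length, delay). The decoding functions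
  are chosen before the burst position \<open>j\<close>.
\<close>

definition feasible ::
    "nat \<Rightarrow> ('q, 'x, 'm) streaming_code_scheme \<Rightarrow> (nat \<times> nat) set \<Rightarrow> bool" where
  "feasible n C R \<longleftrightarrow>
     (\<forall>(b, d) \<in> R. \<exists>\<gamma> :: nat \<Rightarrow> 'x option list \<Rightarrow> 'q list. \<forall>j t.
        AE \<omega> in source_space n C.
          \<gamma> t (map (\<lambda>k. received C b j k \<omega>) [0..<Suc (t + d)]) = \<omega> t)"

end

theory Submission
  imports Defs "HOL-Number_Theory.Cong"
begin

text \<open>
  Lower bound. Suppose \<open>T2 < \<alpha> T + B\<close> and erase the first \<open>\<alpha> B\<close> channel symbols of every period of
  length \<open>\<alpha> T + \<alpha> B - 1\<close>. Period by period, the second decoder recovers all but the last \<open>B\<close> erased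
  source symbols, and the first decoder recovers those. So \<open>\<alpha> T - 1\<close> channel symbols per period
  determine \<open>\<alpha> T + \<alpha> B - 1\<close> source symbols, which forces the rate below \<open>T / (T + B)\<close>.

  Construction. Over a prime field with more than \<open>T\<close> elements, send each source vector with \<open>B\<close>
  parities, each the sum of a parity of a \<open>(B, T)\<close> code running along the diagonals and, delayed by
  \<open>T + B\<close>, a parity of a \<open>((\<alpha> - 1) B, (\<alpha> - 1) T)\<close> code running along the opposite diagonals with step
  \<open>\<alpha> - 1\<close>. Vandermonde coefficients make every system of consecutive parities solvable. Feasibility
  for the first receiver already gives \<open>H(x) \<ge> (T + B) log Q\<close>, so the rate is exact.
\<close>

section \<open>Entropy of simple random variables\<close>

context information_space
begin

lemma entropy_pair_le:
  assumes X: "simple_function M X" and Y: "simple_function M Y"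
  shows "\<H>(\<lambda>\<omega>. (X \<omega>, Y \<omega>)) \<le> \<H>(X) + \<H>(Y)"
  using entropy_chain_rule[OF X Y] conditional_entropy_less_eq_entropy[OF Y X] by simp

text \<open>Independence makes the mutual information vanish, so the conditional entropy in the
  chain rule is \<open>\<H>(Y)\<close>.\<close>

lemma entropy_pair_indep:
  assumes X: "simple_function M X" and Y: "simple_function M Y"
    and indep: "\<And>\<omega>. \<omega> \<in> space M \<Longrightarrow>
      prob ((\<lambda>\<omega>. (X \<omega>, Y \<omega>)) -` {(X \<omega>, Y \<omega>)} \<inter> space M) =
      prob (X -` {X \<omega>} \<inter> space M) * prob (Y -` {Y \<omega>} \<inter> space M)"
  shows "\<H>(\<lambda>\<omega>. (X \<omega>, Y \<omega>)) = \<H>(X) + \<H>(Y)"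
proof -
  have "\<I>(Y ; X) = 0"
  proof (rule mutual_information_eq_0_simple)
    show "simple_distributed M Y (\<lambda>y. prob (Y -` {y} \<inter> space M))"
      by (rule simple_distributedI[OF Y]) auto
    show "simple_distributed M X (\<lambda>y. prob (X -` {y} \<inter> space M))"
      by (rule simple_distributedI[OF X]) auto
    show "simple_distributed M (\<lambda>\<omega>. (Y \<omega>, X \<omega>)) (\<lambda>y. prob ((\<lambda>\<omega>. (Y \<omega>, X \<omega>)) -` {y} \<inter> space M))"
      by (rule simple_distributedI[OF simple_function_Pair[OF Y X]]) auto
    have "(\<lambda>\<omega>. (Y \<omega>, X \<omega>)) -` {(y, x)} = (\<lambda>\<omega>. (X \<omega>, Y \<omega>)) -` {(x, y)}" for x y
      by auto
    then show "\<forall>\<omega>\<in>space M. prob ((\<lambda>\<omega>. (Y \<omega>, X \<omega>)) -` {(Y \<omega>, X \<omega>)} \<inter> space M) =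
        prob (Y -` {Y \<omega>} \<inter> space M) * prob (X -` {X \<omega>} \<inter> space M)"
      using indep by simp
  qed
  then show ?thesis
    using entropy_chain_rule[OF X Y] mutual_information_eq_entropy_conditional_entropy[OF Y X] by simp
qed

text \<open>Values outside the range have probability 0 and contribute
  \<open>0 * log b 0 = 0\<close>. The freedom in \<open>A\<close> lets two variables be summed over
  a common set, and a source symbol over its whole alphabet.\<close>

lemma entropy_superset:
  assumes X: "simple_function M X" and "finite A" "X ` space M \<subseteq> A"
  shows "\<H>(X) = - (\<Sum>x\<in>A. prob (X -` {x} \<inter> space M) * log b (prob (X -` {x} \<inter> space M)))"
proof -
  have "prob (X -` {x} \<inter> space M) = 0" if "x \<notin> X ` space M" for x
  proof -
    have "X -` {x} \<inter> space M = {}"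
      using that by auto
    then show ?thesis by simp
  qed
  then show ?thesis
    unfolding entropy_simple_distributed[OF simple_distributedI[OF X measure_nonneg refl]] neg_equal_iff_equal
    using assms by (intro sum.mono_neutral_left) auto
qed

text \<open>Data processing and subadditivity, one entry at a time. Simplicity is carried along
  because the induction step needs it for the tail.\<close>

lemma entropy_map_le:
  assumes "\<And>k. k \<in> set ks \<Longrightarrow> simple_function M (X k)"
  shows "\<H>(\<lambda>\<omega>. map (\<lambda>k. X k \<omega>) ks) \<le> (\<Sum>k\<leftarrow>ks. \<H>(X k)) \<and>
    simple_function M (\<lambda>\<omega>. map (\<lambda>k. X k \<omega>) ks)"
  using assms
proof (induction ks)
  case Nil
  show ?case
    by (simp, subst entropy_superset[where A = "{[]}"]) (auto simp: prob_space)
next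
  case (Cons k ks)
  let ?Y = "\<lambda>\<omega>. map (\<lambda>k. X k \<omega>) ks"
  have X: "simple_function M (X k)" and Y: "simple_function M ?Y"
    and le: "\<H>(?Y) \<le> (\<Sum>k\<leftarrow>ks. \<H>(X k))"
    using Cons by auto
  have eq: "(\<lambda>\<omega>. map (\<lambda>k. X k \<omega>) (k # ks)) = (\<lambda>(x, y). x # y) \<circ> (\<lambda>\<omega>. (X k \<omega>, ?Y \<omega>))"
    by (simp add: fun_eq_iff)
  have "\<H>(\<lambda>\<omega>. map (\<lambda>k. X k \<omega>) (k # ks)) \<le> \<H>(\<lambda>\<omega>. (X k \<omega>, ?Y \<omega>))"
    unfolding eq by (rule entropy_data_processing[OF simple_function_Pair[OF X Y]])
  also have "\<dots> \<le> \<H>(X k) + \<H>(?Y)"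
    by (rule entropy_pair_le[OF X Y])
  moreover have "simple_function M (\<lambda>\<omega>. map (\<lambda>k. X k \<omega>) (k # ks))"
    unfolding eq by (intro simple_function_compose simple_function_Pair X Y)
  ultimately show ?case
    using le by simp
qed

lemma entropy_cong_AE:
  assumes X: "simple_function M X" and Y: "simple_function M Y"
    and eq: "AE \<omega> in M. X \<omega> = Y \<omega>"
  shows "\<H>(X) = \<H>(Y)"
proof -
  let ?A = "X ` space M \<union> Y ` space M"
  have fin: "finite ?A"
    using X Y by (auto simp: simple_function_def)
  have "prob (X -` {x} \<inter> space M) = prob (Y -` {x} \<inter> space M)" for x
    using eq by (intro finite_measure_eq_AE simple_functionD[OF X] simple_functionD[OF Y]) auto
  then show ?thesis
    by (simp add: entropy_superset[OF X fin] entropy_superset[OF Y fin])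
qed

end

section \<open>I.i.d. sources\<close>

lemma prob_space_symbol:
  assumes "set_pmf (source_dist C) \<subseteq> source_alphabet n C"
  shows "prob_space (restrict_space (measure_pmf (source_dist C)) (source_alphabet n C))"
proof (rule prob_space_restrict_space)
  show "emeasure (measure_pmf (source_dist C)) (source_alphabet n C) = 1"
    using assms measure_pmf.emeasure_eq_1_AE[of "source_alphabet n C" "source_dist C"]
    by (auto simp: AE_measure_pmf_iff)
qed simp

lemma space_symbol:
  "space (restrict_space (measure_pmf (source_dist C)) (source_alphabet n C)) = source_alphabet n C"
  by (simp add: space_restrict_space)

lemma space_source_space: "space (source_space n C) = {\<omega>. \<forall>t. \<omega> t \<in> source_alphabet n C}"
  by (auto simp: source_space_def space_PiM space_symbol PiE_def Pi_def)

text \<open>Asks for less than \<open>is_streaming_code\<close>, so that the source entropy of the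
  constructed code can be computed before its positivity, a part of
  \<open>is_streaming_code\<close>, is shown.\<close>

locale iid_source =
  fixes n :: nat and C :: "('q, 'x, 'm) streaming_code_scheme"
  assumes alphabet_finite: "finite (source_alphabet n C)"
    and supp: "set_pmf (source_dist C) \<subseteq> source_alphabet n C"
begin

abbreviation "\<Omega> \<equiv> source_space n C"

sublocale I: information_space \<Omega> 2
proof -
  interpret prob_space \<Omega>
    unfolding source_space_def by (rule prob_space_PiM) (rule prob_space_symbol[OF supp])
  show "information_space \<Omega> 2"
    by unfold_locales simp
qed

lemma simple_coordinate: "simple_function \<Omega> (\<lambda>\<omega>. \<omega> t)"
proof -
  let ?\<mu> = "restrict_space (measure_pmf (source_dist C)) (source_alphabet n C)"
  have "(\<lambda>\<omega>. \<omega> t) ` space \<Omega> \<subseteq> source_alphabet n C"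
    by (auto simp: space_source_space)
  moreover have meas: "(\<lambda>\<omega>. \<omega> t) \<in> measurable \<Omega> ?\<mu>"
    unfolding source_space_def by (rule measurable_component_singleton) simp
  have "(\<lambda>\<omega>. \<omega> t) -` {x} \<inter> space \<Omega> \<in> sets \<Omega>" if "x \<in> source_alphabet n C" for x
    by (rule measurable_sets[OF meas]) (use that in \<open>auto simp: sets_restrict_space\<close>)
  ultimately show ?thesis
    unfolding simple_function_def
    using finite_subset[OF _ alphabet_finite] by blast
qed

lemma simple_prefix: "simple_function \<Omega> (\<lambda>\<omega>. map \<omega> [0..<m])"
  using I.entropy_map_le[of "[0..<m]" "\<lambda>k \<omega>. \<omega> k"] simple_coordinate by simp

lemma simple_channel: "simple_function \<Omega> (channel_symbol C t)"
  using simple_function_compose[OF simple_prefix[of "Suc t"], of "encoder C t"]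
  by (simp add: channel_symbol_def[abs_def] comp_def)

text \<open>The event is a cylinder over singletons, and a product measure gives it the product of
  the marginal probabilities.\<close>

lemma prob_prefix:
  assumes "length v = m" and "set v \<subseteq> source_alphabet n C"
  shows "I.prob ((\<lambda>\<omega>. map \<omega> [0..<m]) -` {v} \<inter> space \<Omega>) = (\<Prod>i<m. pmf (source_dist C) (v ! i))"
proof -
  let ?\<mu> = "restrict_space (measure_pmf (source_dist C)) (source_alphabet n C)"
  interpret product_prob_space "\<lambda>_. ?\<mu>" UNIV
    using prob_space_symbol[OF supp]
    by (simp add: product_prob_space_def product_sigma_finite_def prob_space_imp_sigma_finite
        product_prob_space_axioms_def)
  have v: "v ! i \<in> source_alphabet n C" if "i < m" for i
    using that assms nth_mem by blast
  have map_eq: "map \<omega> [0..<m] = v \<longleftrightarrow> (\<forall>i<m. \<omega> i = v ! i)" for \<omega>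
    using assms(1) by (simp add: list_eq_iff_nth_eq)
  have "prod_emb UNIV (\<lambda>_. ?\<mu>) {..<m} (\<Pi>\<^sub>E i\<in>{..<m}. {v ! i}) =
      (\<Pi>\<^sub>E i\<in>UNIV. if i \<in> {..<m} then {v ! i} else source_alphabet n C)"
    using v by (subst prod_emb_PiE, unfold space_symbol) auto
  also have "\<dots> = (\<lambda>\<omega>. map \<omega> [0..<m]) -` {v} \<inter> space \<Omega>"
  proof (rule Set.set_eqI, rule iffI)
    fix \<omega> assume "\<omega> \<in> (\<Pi>\<^sub>E i\<in>UNIV. if i \<in> {..<m} then {v ! i} else source_alphabet n C)"
    then have "\<omega> i \<in> (if i \<in> {..<m} then {v ! i} else source_alphabet n C)" for i
      by (simp add: PiE_iff)
    then show "\<omega> \<in> (\<lambda>\<omega>. map \<omega> [0..<m]) -` {v} \<inter> space \<Omega>"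
      using v unfolding vimage_def Int_iff space_source_space mem_Collect_eq singleton_iff map_eq
      by (metis lessThan_iff singletonD)
  next
    fix \<omega> assume "\<omega> \<in> (\<lambda>\<omega>. map \<omega> [0..<m]) -` {v} \<inter> space \<Omega>"
    then have "(\<forall>i<m. \<omega> i = v ! i) \<and> (\<forall>i. \<omega> i \<in> source_alphabet n C)"
      unfolding vimage_def Int_iff space_source_space mem_Collect_eq singleton_iff map_eq .
    then show "\<omega> \<in> (\<Pi>\<^sub>E i\<in>UNIV. if i \<in> {..<m} then {v ! i} else source_alphabet n C)"
      by (simp add: PiE_iff)
  qed
  finally have eq: "(\<lambda>\<omega>. map \<omega> [0..<m]) -` {v} \<inter> space \<Omega> =
      prod_emb UNIV (\<lambda>_. ?\<mu>) {..<m} (\<Pi>\<^sub>E i\<in>{..<m}. {v ! i})" ..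
  have "I.prob ((\<lambda>\<omega>. map \<omega> [0..<m]) -` {v} \<inter> space \<Omega>) = (\<Prod>i<m. measure ?\<mu> {v ! i})"
    unfolding eq unfolding source_space_def
    using v by (subst measure_PiM_emb) (auto simp: sets_restrict_space)
  also have "\<dots> = (\<Prod>i<m. pmf (source_dist C) (v ! i))"
    using v by (intro prod.cong) (auto simp: measure_restrict_space pmf.rep_eq)
  finally show ?thesis .
qed

lemma prob_coordinate:
  assumes "x \<in> source_alphabet n C"
  shows "I.prob ((\<lambda>\<omega>. \<omega> t) -` {x} \<inter> space \<Omega>) = pmf (source_dist C) x"
proof -
  let ?\<mu> = "restrict_space (measure_pmf (source_dist C)) (source_alphabet n C)"
  have "distr \<Omega> ?\<mu> (\<lambda>\<omega>. \<omega> t) = ?\<mu>"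
    unfolding source_space_def by (rule distr_PiM_component[OF prob_space_symbol[OF supp]]) simp
  moreover have "(\<lambda>\<omega>. \<omega> t) \<in> measurable \<Omega> ?\<mu>"
    unfolding source_space_def by (rule measurable_component_singleton) simp
  moreover have "{x} \<in> sets ?\<mu>"
    using assms by (auto simp: sets_restrict_space)
  ultimately have "I.prob ((\<lambda>\<omega>. \<omega> t) -` {x} \<inter> space \<Omega>) = measure ?\<mu> {x}"
    by (metis measure_distr)
  then show ?thesis
    using assms by (simp add: measure_restrict_space pmf.rep_eq)
qed

lemma entropy_coordinate:
  "rv_entropy \<Omega> (\<lambda>\<omega>. \<omega> t) =
    - (\<Sum>x\<in>source_alphabet n C. pmf (source_dist C) x * log 2 (pmf (source_dist C) x))"
  unfolding rv_entropy_def
  by (subst I.entropy_superset[OF simple_coordinate alphabet_finite])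
     (auto simp: space_source_space prob_coordinate[unfolded space_source_space])

text \<open>Appending is an injective function of the prefix and the new symbol, which are
  independent, so each step adds one source entropy.\<close>

lemma entropy_prefix: "rv_entropy \<Omega> (\<lambda>\<omega>. map \<omega> [0..<m]) = m * source_entropy n C"
proof (induction m)
  case 0
  have "rv_entropy \<Omega> (\<lambda>\<omega>. []) = 0"
    unfolding rv_entropy_def
    by (subst I.entropy_superset[where A = "{[]}"]) (auto simp: I.prob_space)
  then show ?case by simp
next
  case (Suc m)
  let ?X = "\<lambda>\<omega>. map \<omega> [0..<m]"
  let ?Y = "\<lambda>\<omega>. \<omega> m"
  have "rv_entropy \<Omega> (\<lambda>\<omega>. map \<omega> [0..<Suc m]) = rv_entropy \<Omega> ((\<lambda>(x, y). x @ [y]) \<circ> (\<lambda>\<omega>. (?X \<omega>, ?Y \<omega>)))"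
    by (simp add: comp_def)
  also have "\<dots> = rv_entropy \<Omega> (\<lambda>\<omega>. (?X \<omega>, ?Y \<omega>))"
    unfolding rv_entropy_def
    by (rule I.entropy_of_inj[OF simple_function_Pair[OF simple_prefix simple_coordinate]])
       (auto simp: inj_on_def)
  also have "\<dots> = rv_entropy \<Omega> ?X + rv_entropy \<Omega> ?Y"
    unfolding rv_entropy_def
  proof (rule I.entropy_pair_indep[OF simple_prefix simple_coordinate])
    fix \<omega> assume \<omega>: "\<omega> \<in> space \<Omega>"
    have "(\<lambda>\<omega>. (?X \<omega>, ?Y \<omega>)) -` {(?X \<omega>, ?Y \<omega>)} = (\<lambda>\<omega>. map \<omega> [0..<Suc m]) -` {map \<omega> [0..<Suc m]}"
      by auto
    then have "I.prob ((\<lambda>\<omega>. (?X \<omega>, ?Y \<omega>)) -` {(?X \<omega>, ?Y \<omega>)} \<inter> space \<Omega>) =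
        (\<Prod>i<Suc m. pmf (source_dist C) (map \<omega> [0..<Suc m] ! i))"
      using \<omega> by (simp only: prob_prefix) (rule prob_prefix, auto simp: space_source_space)
    also have "\<dots> = (\<Prod>i<m. pmf (source_dist C) (?X \<omega> ! i)) * pmf (source_dist C) (?Y \<omega>)"
      by (simp add: nth_append)
    also have "\<dots> = I.prob (?X -` {?X \<omega>} \<inter> space \<Omega>) * I.prob (?Y -` {?Y \<omega>} \<inter> space \<Omega>)"
    proof -
      have "\<omega> t \<in> source_alphabet n C" for t
        using \<omega> by (simp add: space_source_space)
      then show ?thesis
        by (subst prob_prefix) (auto simp: prob_coordinate)
    qed
    finally show "I.prob ((\<lambda>\<omega>. (?X \<omega>, ?Y \<omega>)) -` {(?X \<omega>, ?Y \<omega>)} \<inter> space \<Omega>) =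
        I.prob (?X -` {?X \<omega>} \<inter> space \<Omega>) * I.prob (?Y -` {?Y \<omega>} \<inter> space \<Omega>)" .
  qed
  also have "rv_entropy \<Omega> ?Y = source_entropy n C"
    unfolding source_entropy_def entropy_coordinate ..
  finally show ?case
    using Suc by (simp add: algebra_simps)
qed

end

section \<open>Recovery and the lower bound on the delay\<close>

lemma channel_symbol_cong:
  assumes "\<And>k. k \<le> t \<Longrightarrow> \<omega> k = \<omega>' k"
  shows "channel_symbol C t \<omega> = channel_symbol C t \<omega>'"
proof -
  have "map \<omega> [0..<Suc t] = map \<omega>' [0..<Suc t]"
    using assms by (intro map_cong) auto
  then show ?thesis
    unfolding channel_symbol_def by (rule arg_cong)
qed

text \<open>Feasibility with decoders and probability removed: what is received must determine the
  symbol. \<open>G\<close> is an almost sure set of sample paths for the lower bound and the whole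
  space for the construction.\<close>

definition separated ::
    "('q, 'x, 'm) streaming_code_scheme \<Rightarrow> nat \<Rightarrow> nat \<Rightarrow> (nat \<Rightarrow> 'q list) set \<Rightarrow> bool" where
  "separated C b d G \<longleftrightarrow> (\<forall>\<omega>\<in>G. \<forall>\<omega>'\<in>G. \<forall>j t.
     (\<forall>k \<le> t + d. k < j \<or> j + b \<le> k \<longrightarrow> channel_symbol C k \<omega> = channel_symbol C k \<omega>') \<longrightarrow>
     \<omega> t = \<omega>' t)"

lemma separatedD:
  assumes "separated C b d G" "\<omega> \<in> G" "\<omega>' \<in> G"
    and "\<And>k. k \<le> t + d \<Longrightarrow> k < j \<or> j + b \<le> k \<Longrightarrow> channel_symbol C k \<omega> = channel_symbol C k \<omega>'"
  shows "\<omega> t = \<omega>' t"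
  using assms unfolding separated_def by blast

text \<open>The decoder outputs the symbol at time \<open>t\<close> of any path that could have
  produced the received word; separation makes it unique.\<close>

lemma feasible_if_separated:
  assumes "\<And>b d. (b, d) \<in> R \<Longrightarrow> separated C b d (space (source_space n C))"
  shows "feasible n C R"
  unfolding feasible_def
proof safe
  fix b d assume R: "(b, d) \<in> R"
  let ?y = "\<lambda>j t \<omega>. map (\<lambda>k. received C b j k \<omega>) [0..<Suc (t + d)]"
  let ?dec = "\<lambda>y t s. \<exists>j \<omega>. \<omega> \<in> space (source_space n C) \<and> y = ?y j t \<omega> \<and> s = \<omega> t"
  \<comment> \<open>The burst positions may differ, since the decoder is not told them. Wherever the
    first word shows a symbol, equality makes the second show the same one, so separation with burst
    \<open>j\<close> applies.\<close>
  have unique: "\<omega> t = \<omega>' t"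
    if \<omega>: "\<omega> \<in> space (source_space n C)" "\<omega>' \<in> space (source_space n C)"
      and y: "?y j t \<omega> = ?y j' t \<omega>'" for j j' t \<omega> \<omega>'
  proof (rule separatedD[OF assms[OF R] \<omega>])
    fix k assume k: "k \<le> t + d" "k < j \<or> j + b \<le> k"
    then have "received C b j k \<omega> = received C b j' k \<omega>'"
      using y unfolding map_eq_conv by (simp del: upt_Suc)
    then show "channel_symbol C k \<omega> = channel_symbol C k \<omega>'"
      using k by (auto simp: received_def split: if_splits)
  qed
  have "(SOME s. ?dec (?y j t \<omega>) t s) = \<omega> t" if "\<omega> \<in> space (source_space n C)" for j t \<omega>
  proof (rule some_equality)
    show "?dec (?y j t \<omega>) t (\<omega> t)"
      using that by blast
  next
    fix s assume "?dec (?y j t \<omega>) t s"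
    then obtain j' \<omega>' where "\<omega>' \<in> space (source_space n C)" "?y j t \<omega> = ?y j' t \<omega>'" "s = \<omega>' t"
      by blast
    then show "s = \<omega> t"
      using unique[OF that, of \<omega>' j t j'] by simp
  qed
  then show "\<exists>\<gamma> :: nat \<Rightarrow> 'b option list \<Rightarrow> 'a list. \<forall>j t. AE \<omega> in source_space n C. \<gamma> t (?y j t \<omega>) = \<omega> t"
    by (intro exI[of _ "\<lambda>t y. SOME s. ?dec y t s"] allI AE_I2)
qed

section \<open>Entropy bounds for feasible codes\<close>

locale streaming_source =
  fixes n :: nat and C :: "('q, 'x, 'm) streaming_code_scheme"
  assumes code: "is_streaming_code n C"
begin

sublocale iid_source n C
  using code by unfold_locales
    (auto simp: is_streaming_code_def source_alphabet_def intro: finite_lists_length_eq)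

text \<open>Bounds the set whose supremum is \<open>channel_entropy\<close>, and caps the channel
  entropy of the constructed code in the rate computation.\<close>

lemma channel_entropy_bound:
  "rv_entropy \<Omega> (channel_symbol C t) \<le> log 2 (card (channel_alphabet C))"
proof -
  have "map \<omega> [0..<Suc t] \<in> {w. length w = Suc t \<and> set w \<subseteq> source_alphabet n C}" if "\<omega> \<in> space \<Omega>" for \<omega>
    using that by (auto simp: space_source_space)
  then have sub: "channel_symbol C t ` space \<Omega> \<subseteq> channel_alphabet C"
    using code unfolding is_streaming_code_def channel_symbol_def by blast
  have fin: "finite (channel_alphabet C)"
    using code by (simp add: is_streaming_code_def)
  have "rv_entropy \<Omega> (channel_symbol C t) \<le> log 2 (card (channel_symbol C t ` space \<Omega>))"
    unfolding rv_entropy_def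
    by (rule I.entropy_le_card[OF I.simple_distributedI[OF simple_channel _ refl]]) simp
  also have "\<dots> \<le> log 2 (card (channel_alphabet C))"
    using card_mono[OF fin sub] I.not_empty finite_subset[OF sub fin]
    by (intro log_mono) (auto simp: card_gt_0_iff)
  finally show ?thesis .
qed

lemma channel_entropy_upper: "rv_entropy \<Omega> (channel_symbol C t) \<le> channel_entropy n C"
  unfolding channel_entropy_def
  by (rule cSUP_upper) (use channel_entropy_bound in \<open>auto intro!: bdd_aboveI2\<close>)

text \<open>All decoders succeed simultaneously on an almost sure set, because receivers, burst
  positions and times are countably many. On that set, equal received words give equal decoder
  outputs.\<close>

lemma feasible_separated:
  assumes "feasible n C R"
  obtains G where "AE \<omega> in \<Omega>. \<omega> \<in> G" "\<And>b d. (b, d) \<in> R \<Longrightarrow> separated C b d G"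
proof -
  have "\<forall>r\<in>R. \<exists>\<gamma> :: nat \<Rightarrow> 'x option list \<Rightarrow> 'q list. \<forall>j t. AE \<omega> in \<Omega>.
      \<gamma> t (map (\<lambda>k. received C (fst r) j k \<omega>) [0..<Suc (t + snd r)]) = \<omega> t"
    using assms unfolding feasible_def by auto
  then obtain \<gamma> :: "nat \<times> nat \<Rightarrow> nat \<Rightarrow> 'x option list \<Rightarrow> 'q list" where
    \<gamma>: "\<And>r j t. r \<in> R \<Longrightarrow> AE \<omega> in \<Omega>.
      \<gamma> r t (map (\<lambda>k. received C (fst r) j k \<omega>) [0..<Suc (t + snd r)]) = \<omega> t"
    unfolding bchoice_iff by blast
  define G where "G = {\<omega>. \<forall>r\<in>R. \<forall>j t.
    \<gamma> r t (map (\<lambda>k. received C (fst r) j k \<omega>) [0..<Suc (t + snd r)]) = \<omega> t}"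
  have "AE \<omega> in \<Omega>. \<omega> \<in> G"
    unfolding G_def mem_Collect_eq
    by (intro AE_ball_countable' AE_all_countable[THEN iffD2] allI \<gamma>) auto
  moreover have "separated C b d G" if R: "(b, d) \<in> R" for b d
    unfolding separated_def
  proof (intro ballI allI impI)
    fix \<omega> \<omega>' j t
    assume \<omega>: "\<omega> \<in> G" "\<omega>' \<in> G"
      and eq: "\<forall>k \<le> t + d. k < j \<or> j + b \<le> k \<longrightarrow> channel_symbol C k \<omega> = channel_symbol C k \<omega>'"
    have "map (\<lambda>k. received C b j k \<omega>) [0..<Suc (t + d)] = map (\<lambda>k. received C b j k \<omega>') [0..<Suc (t + d)]"
      using eq by (intro map_cong) (auto simp: received_def)
    moreover have "\<gamma> (b, d) t (map (\<lambda>k. received C b j k \<omega>) [0..<Suc (t + d)]) = \<omega> t" if "\<omega> \<in> G" for \<omega>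
      using that[unfolded G_def mem_Collect_eq, THEN bspec, OF R] by (simp del: upt_Suc)
    ultimately show "\<omega> t = \<omega>' t"
      using \<omega> by metis
  qed
  ultimately show ?thesis
    using that by blast
qed

text \<open>
  Here the channel erases the first \<open>E\<close> symbols of every period of length \<open>P\<close>.
\<close>

lemma entropy_bound_of_periodic_recovery:
  fixes E P :: nat
  assumes "E < P" and G: "AE \<omega> in \<Omega>. \<omega> \<in> G"
    and recover: "\<And>m \<omega> \<omega>' k. \<omega> \<in> G \<Longrightarrow> \<omega>' \<in> G \<Longrightarrow>
      (\<And>i. i < m \<Longrightarrow> channel_symbol C i \<omega> = channel_symbol C i \<omega>') \<Longrightarrow>
      (\<And>i. m + E \<le> i \<Longrightarrow> i < m + P \<Longrightarrow> channel_symbol C i \<omega> = channel_symbol C i \<omega>') \<Longrightarrow>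
      k < m + E \<Longrightarrow> \<omega> k = \<omega>' k"
  shows "P * source_entropy n C \<le> (P - E) * channel_entropy n C"
proof -
  \<comment> \<open>The times left unerased during the first \<open>N\<close> periods.\<close>
  define ks where "ks N = concat (map (\<lambda>i. [i * P + E..<i * P + P]) [0..<N])" for N
  define Y where "Y N \<omega> = map (\<lambda>k. channel_symbol C k \<omega>) (ks N)" for N \<omega>
  have length_ks: "length (ks N) = N * (P - E)" for N
    by (induction N) (auto simp: ks_def)
  have Y_eq: "channel_symbol C i \<omega> = channel_symbol C i \<omega>'"
    if "Y N \<omega> = Y N \<omega>'" "j < N" "j * P + E \<le> i" "i < j * P + P" for N \<omega> \<omega>' i j
    using that by (auto simp: Y_def ks_def)
  \<comment> \<open>Induction over periods: the recovered source symbols are re-encoded into the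
    erased channel symbols, so the next period starts with a complete past.\<close>
  have all_symbols: "channel_symbol C i \<omega> = channel_symbol C i \<omega>'"
    if "\<omega> \<in> G" "\<omega>' \<in> G" "Y N \<omega> = Y N \<omega>'" "j \<le> N" "i < j * P" for N \<omega> \<omega>' i j
    using that(4,5)
  proof (induction j arbitrary: i)
    case (Suc j)
    show ?case
    proof (cases "i < j * P + E")
      case True
      have "\<omega> k = \<omega>' k" if "k \<le> i" for k
        by (rule recover[OF \<open>\<omega> \<in> G\<close> \<open>\<omega>' \<in> G\<close>, of "j * P"])
           (use that True Suc Y_eq[OF \<open>Y N \<omega> = Y N \<omega>'\<close>, of j] in auto)
      then show ?thesis
        by (rule channel_symbol_cong)
    next
      case False
      then show ?thesis
        using Y_eq[OF that(3), of j i] Suc.prems by auto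
    qed
  qed auto
  \<comment> \<open>The extra period in \<open>Suc N\<close> serves as lookahead:
    \<open>recover\<close> at \<open>m = N * P\<close> uses the unerased symbols of period
    \<open>N\<close>, counted from 0.\<close>
  have bound: "N * (P * source_entropy n C) \<le> Suc N * ((P - E) * channel_entropy n C)" for N
  proof -
    \<comment> \<open>Reconstruction from the unerased symbols: take the source prefix of any path
      in \<open>G\<close> that produces them.\<close>
    define F where "F y = map (SOME \<omega>. \<omega> \<in> G \<and> Y (Suc N) \<omega> = y) [0..<N * P]" for y
    have F: "F (Y (Suc N) \<omega>) = map \<omega> [0..<N * P]" if "\<omega> \<in> G" for \<omega>
    proof -
      define \<omega>' where "\<omega>' = (SOME \<omega>'. \<omega>' \<in> G \<and> Y (Suc N) \<omega>' = Y (Suc N) \<omega>)"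
      have \<omega>': "\<omega>' \<in> G" "Y (Suc N) \<omega>' = Y (Suc N) \<omega>"
        using someI[of "\<lambda>\<omega>'. \<omega>' \<in> G \<and> Y (Suc N) \<omega>' = Y (Suc N) \<omega>", OF conjI[OF that refl]]
        unfolding \<omega>'_def by blast+
      have "\<omega>' k = \<omega> k" if k: "k < N * P" for k
        by (rule recover[OF \<omega>'(1) \<open>\<omega> \<in> G\<close>, of "N * P"])
           (use all_symbols[OF \<omega>'(1) \<open>\<omega> \<in> G\<close> \<omega>'(2), of N] Y_eq[OF \<omega>'(2), of N] k in auto)
      then show ?thesis
        unfolding F_def \<omega>'_def[symmetric] by auto
    qed
    have simple_Y: "simple_function \<Omega> (Y (Suc N))"
      using I.entropy_map_le[of "ks (Suc N)" "channel_symbol C"] simple_channel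
      by (simp add: Y_def[abs_def])
    have "N * (P * source_entropy n C) = rv_entropy \<Omega> (\<lambda>\<omega>. map \<omega> [0..<N * P])"
      by (simp add: entropy_prefix)
    also have "\<dots> = rv_entropy \<Omega> (F \<circ> Y (Suc N))"
      unfolding rv_entropy_def
      by (rule I.entropy_cong_AE[OF simple_prefix simple_function_compose[OF simple_Y]])
         (use G F in \<open>auto elim!: eventually_mono\<close>)
    also have "\<dots> \<le> rv_entropy \<Omega> (Y (Suc N))"
      unfolding rv_entropy_def by (rule I.entropy_data_processing[OF simple_Y])
    also have "\<dots> \<le> (\<Sum>k\<leftarrow>ks (Suc N). rv_entropy \<Omega> (channel_symbol C k))"
      using I.entropy_map_le[of "ks (Suc N)" "channel_symbol C"] simple_channel
      by (simp add: Y_def[abs_def] rv_entropy_def)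
    also have "\<dots> \<le> (\<Sum>k\<leftarrow>ks (Suc N). channel_entropy n C)"
      by (intro sum_list_mono channel_entropy_upper)
    also have "\<dots> = Suc N * ((P - E) * channel_entropy n C)"
      by (simp only: sum_list_triv length_ks of_nat_mult mult.assoc)
    finally show ?thesis .
  qed
  show ?thesis
  \<comment> \<open>If the claim failed, the deficit would grow linearly in \<open>N\<close> and
    exceed the cost of the one extra period.\<close>
  proof (rule ccontr)
    assume "\<not> ?thesis"
    then obtain N :: nat where
      "(P - E) * channel_entropy n C < N * (P * source_entropy n C - (P - E) * channel_entropy n C)"
      using reals_Archimedean3[of "P * source_entropy n C - (P - E) * channel_entropy n C"] by auto
    with bound[of N] show False
      by (simp add: algebra_simps)
  qed
qed

text \<open>Converse for one receiver, with period \<open>b + d\<close>: the last symbol of a burst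
  at \<open>m\<close> is decoded by time \<open>m + b + d - 1\<close>, when the period ends. It also
  supplies the lower bound on the channel entropy of the constructed code.\<close>

lemma entropy_bound_single:
  assumes "feasible n C R" "(b, d) \<in> R" "0 < d"
  shows "(b + d) * source_entropy n C \<le> d * channel_entropy n C"
proof -
  obtain G where G: "AE \<omega> in \<Omega>. \<omega> \<in> G" and "\<And>b d. (b, d) \<in> R \<Longrightarrow> separated C b d G"
    using feasible_separated[OF assms(1)] by blast
  then have sep: "separated C b d G"
    using assms(2) by blast
  have "real (b + d) * source_entropy n C \<le> real (b + d - b) * channel_entropy n C"
  proof (rule entropy_bound_of_periodic_recovery[OF _ G])
    fix m \<omega> \<omega>' k
    assume "\<omega> \<in> G" "\<omega>' \<in> G" and k: "k < m + b"
      and eq: "\<And>i. i < m \<Longrightarrow> channel_symbol C i \<omega> = channel_symbol C i \<omega>'"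
        "\<And>i. m + b \<le> i \<Longrightarrow> i < m + (b + d) \<Longrightarrow> channel_symbol C i \<omega> = channel_symbol C i \<omega>'"
    then show "\<omega> k = \<omega>' k"
      by (intro separatedD[OF sep, of \<omega> \<omega>' k m]) (use k eq in auto)
  qed (use assms in simp)
  then show ?thesis by simp
qed

lemma entropy_bound_pair:
  assumes "feasible n C R" "(B, T) \<in> R" "(\<alpha> * B, T2) \<in> R"
    and "1 \<le> B" "1 \<le> T" "2 \<le> \<alpha>" and T2: "T2 < \<alpha> * T + B"
  shows "(real (\<alpha> * T + \<alpha> * B) - 1) * source_entropy n C \<le> (real (\<alpha> * T) - 1) * channel_entropy n C"
proof -
  obtain G where G: "AE \<omega> in \<Omega>. \<omega> \<in> G" and sep: "\<And>b d. (b, d) \<in> R \<Longrightarrow> separated C b d G"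
    using feasible_separated[OF assms(1)] by blast
  obtain \<beta> where \<beta>: "\<alpha> = Suc \<beta>" "1 \<le> \<beta>"
    using assms(6) by (cases \<alpha>) auto
  have "1 \<le> \<beta> * T"
    using \<beta> assms by simp
  moreover have "\<alpha> * T = \<beta> * T + T"
    using \<beta> by simp
  ultimately have \<alpha>T: "T < \<alpha> * T" "1 < \<alpha> * T"
    using assms(5) by linarith+
  have \<alpha>B: "\<alpha> * B = \<beta> * B + B"
    using \<beta> by simp
  have "real (\<alpha> * T + \<alpha> * B - 1) * source_entropy n C \<le>
      real (\<alpha> * T + \<alpha> * B - 1 - \<alpha> * B) * channel_entropy n C"
  proof (rule entropy_bound_of_periodic_recovery[OF _ G])
    fix m \<omega> \<omega>' k
    assume \<omega>: "\<omega> \<in> G" "\<omega>' \<in> G" and k: "k < m + \<alpha> * B"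
      and before: "\<And>i. i < m \<Longrightarrow> channel_symbol C i \<omega> = channel_symbol C i \<omega>'"
      and after: "\<And>i. m + \<alpha> * B \<le> i \<Longrightarrow> i < m + (\<alpha> * T + \<alpha> * B - 1) \<Longrightarrow>
        channel_symbol C i \<omega> = channel_symbol C i \<omega>'"
    \<comment> \<open>Since \<open>T2 \<le> \<alpha> * T + B - 1\<close>, decoding the symbol at
      \<open>m + \<beta> * B - 1\<close> looks no further than
      \<open>m + \<alpha> * T + \<alpha> * B - 2\<close>, the last time of the period.\<close>
    have early: "\<omega> t = \<omega>' t" if "t < m + \<beta> * B" for t
      by (rule separatedD[OF sep[OF assms(3)] \<omega>, of _ m])
         (use that before after T2 \<alpha>B in auto)
    \<comment> \<open>Re-encoding shrinks the burst to its last \<open>B\<close> positions, which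
      the first decoder handles.\<close>
    then have before': "channel_symbol C i \<omega> = channel_symbol C i \<omega>'" if "i < m + \<beta> * B" for i
      using that by (intro channel_symbol_cong) auto
    show "\<omega> k = \<omega>' k"
    proof (rule separatedD[OF sep[OF assms(2)] \<omega>, of _ "m + \<beta> * B"])
      fix i assume "i \<le> k + T" and "i < m + \<beta> * B \<or> m + \<beta> * B + B \<le> i"
      moreover have "k + T < m + (\<alpha> * T + \<alpha> * B - 1)"
        using k \<alpha>T by linarith
      ultimately show "channel_symbol C i \<omega> = channel_symbol C i \<omega>'"
        using before'[of i] after[of i] \<alpha>B by linarith
    qed
  qed (use \<alpha>T in simp)
  then show ?thesis
    using \<alpha>T by (simp add: of_nat_diff)
qed

lemma delay_lower_bound:
  assumes "feasible n C R" "(B, T) \<in> R" "(\<alpha> * B, T2) \<in> R"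
    and "1 \<le> B" "1 \<le> T" "2 \<le> \<alpha>" and rate: "rate n C = real T / real (T + B)"
  shows "\<alpha> * T + B \<le> T2"
proof (rule ccontr)
  assume "\<not> ?thesis"
  then have bound: "(real (\<alpha> * T + \<alpha> * B) - 1) * source_entropy n C \<le> (real (\<alpha> * T) - 1) * channel_entropy n C"
    using entropy_bound_pair[OF assms(1-6)] by simp
  have Hs: "0 < source_entropy n C"
    using code by (simp add: is_streaming_code_def)
  \<comment> \<open>Division by zero gives 0, which the positive rate excludes.\<close>
  have "channel_entropy n C \<noteq> 0"
    using rate assms by (auto simp: rate_def)
  then have eq: "channel_entropy n C * T = source_entropy n C * (T + B)"
    using rate assms by (simp add: rate_def field_simps)
  \<comment> \<open>Multiplying by \<open>T\<close> and eliminating the channel entropy cancels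
    everything except \<open>source_entropy n C * B\<close>.\<close>
  have "T * ((real (\<alpha> * T + \<alpha> * B) - 1) * source_entropy n C) \<le> T * ((real (\<alpha> * T) - 1) * channel_entropy n C)"
    using bound by (intro mult_left_mono) auto
  also have "\<dots> = (real (\<alpha> * T) - 1) * (source_entropy n C * (T + B))"
    using eq by (simp add: mult.commute)
  finally have "source_entropy n C * B \<le> 0"
    by (simp add: algebra_simps)
  then show False
    using Hs assms by (simp add: mult_le_0_iff)
qed

end

section \<open>Burst recovery modulo a prime\<close>

text \<open>Combine the equations with the coefficients of a polynomial \<open>f\<close> that
  vanishes at all nodes of the support except \<open>y i\<close>. Only the term of \<open>i\<close>
  survives modulo \<open>p\<close>, and neither the power of \<open>y i\<close> nor the value of
  \<open>f\<close> there is divisible by \<open>p\<close>.\<close>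

lemma vandermonde_dvd:
  fixes p :: int and y c :: "'a \<Rightarrow> int"
  assumes "prime p" and fin: "finite A"
    and nz: "\<And>j. j \<in> A \<Longrightarrow> \<not> p dvd y j"
    and distinct: "\<And>j j'. j \<in> A \<Longrightarrow> j' \<in> A \<Longrightarrow> j \<noteq> j' \<Longrightarrow> \<not> p dvd y j - y j'"
    and eq: "\<And>k. k0 \<le> k \<Longrightarrow> k < k0 + m \<Longrightarrow> p dvd (\<Sum>j\<in>A. y j ^ k * c j)"
    and supp: "card {j \<in> A. \<not> p dvd c j} \<le> m"
    and "i \<in> A"
  shows "p dvd c i"
proof (rule ccontr)
  assume c: "\<not> p dvd c i"
  define S where "S = {j \<in> A. \<not> p dvd c j}"
  define f where "f = (\<Prod>j\<in>S - {i}. [:- y j, 1:])"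
  have S: "finite S" "i \<in> S" "S \<subseteq> A"
    using fin c \<open>i \<in> A\<close> by (auto simp: S_def)
  have poly_f: "poly f x = (\<Prod>j\<in>S - {i}. x - y j)" for x
    by (simp add: f_def poly_prod)
  have "degree f \<le> sum (degree \<circ> (\<lambda>j. [:- y j, 1:])) (S - {i})"
    unfolding f_def by (rule degree_prod_sum_le) (use S in auto)
  \<comment> \<open>Because \<open>i\<close> is left out, the degree is below \<open>m\<close> and
    every coefficient of \<open>f\<close> meets an available equation.\<close>
  also have "\<dots> < card S"
    using card_Diff1_less[OF S(1,2)] by simp
  finally have deg: "degree f < m"
    using supp by (simp add: S_def)
  have "(\<Sum>j\<in>A. y j ^ k0 * poly f (y j) * c j) =
      (\<Sum>j\<in>A. \<Sum>l\<le>degree f. coeff f l * (y j ^ (k0 + l) * c j))"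
    unfolding poly_altdef sum_distrib_left sum_distrib_right
    by (intro sum.cong refl) (simp add: power_add)
  also have "\<dots> = (\<Sum>l\<le>degree f. coeff f l * (\<Sum>j\<in>A. y j ^ (k0 + l) * c j))"
    by (subst sum.swap) (simp add: sum_distrib_left)
  also have "p dvd \<dots>"
    using deg by (intro dvd_sum dvd_mult eq) auto
  finally have "p dvd (\<Sum>j\<in>A. y j ^ k0 * poly f (y j) * c j)" .
  moreover have "p dvd (\<Sum>j\<in>A - {i}. y j ^ k0 * poly f (y j) * c j)"
  proof (rule dvd_sum)
    fix j assume j: "j \<in> A - {i}"
    show "p dvd y j ^ k0 * poly f (y j) * c j"
    proof (cases "j \<in> S")
      case True
      then have "poly f (y j) = 0"
        unfolding poly_f using S j by (intro prod_zero) auto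
      then show ?thesis by simp
    qed (use j in \<open>simp add: S_def\<close>)
  qed
  ultimately have "p dvd y i ^ k0 * poly f (y i) * c i"
    using sum.remove[OF fin \<open>i \<in> A\<close>, of "\<lambda>j. y j ^ k0 * poly f (y j) * c j"]
    by (simp add: dvd_add_left_iff)
  then have "p dvd y i ^ k0 \<or> p dvd poly f (y i)"
    using c \<open>prime p\<close> by (simp add: prime_dvd_mult_iff)
  moreover have "\<not> p dvd y i ^ k0"
    using nz[OF \<open>i \<in> A\<close>] \<open>prime p\<close> prime_dvd_power by blast
  moreover have "\<not> p dvd poly f (y i)"
    unfolding poly_f using S distinct \<open>i \<in> A\<close> \<open>prime p\<close>
    by (subst prime_dvd_prod_iff) auto
  ultimately show False by blast
qed

section \<open>The parity codes and their burst decoding\<close>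

locale multicast_parameters =
  fixes B T \<beta> :: nat and p :: int
  assumes B: "1 \<le> B" and BT: "B \<le> T" and \<beta>: "1 \<le> \<beta>" and p: "prime p" and Tp: "int T < p"
begin

text \<open>
  \<open>\<sigma> j i\<close> is the \<open>j\<close>-th entry of the source vector at time \<open>i\<close>. The first \<open>B\<close> entries are the urgent
  ones of the first code and the last \<open>B\<close> those of the second, whose entries are numbered backwards.
\<close>

definition parity1 :: "(nat \<Rightarrow> int \<Rightarrow> int) \<Rightarrow> nat \<Rightarrow> int \<Rightarrow> int" where
  "parity1 \<sigma> k t = \<sigma> k (t - int T) + (\<Sum>j\<in>{B..<T}. (1 + int j) ^ k * \<sigma> j (t - int T - int k + int j))"

text \<open>With \<open>e = t - \<beta> * (k + 1)\<close>, entry \<open>j\<close> is read at time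
  \<open>e - \<beta> * j\<close>, the urgent one included, so the codewords run along the opposite
  diagonals.\<close>

definition parity2 :: "(nat \<Rightarrow> int \<Rightarrow> int) \<Rightarrow> nat \<Rightarrow> int \<Rightarrow> int" where
  "parity2 \<sigma> k t = \<sigma> (T - 1 - k) (t - int \<beta> * int T) +
    (\<Sum>j\<in>{..<T - B}. (int T - int j) ^ k * \<sigma> j (t - int \<beta> * (int k + int j + 1)))"

text \<open>The shift raises the delay of the second code's urgent entries to
  \<open>\<beta> * T + T + B\<close>, the target for \<alpha> = \<beta> + 1. While the first decoder
  repairs a burst of length \<open>B\<close>, it also makes the second summand read only symbols
  from before the burst.\<close>

definition parity :: "(nat \<Rightarrow> int \<Rightarrow> int) \<Rightarrow> nat \<Rightarrow> int \<Rightarrow> int" where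
  "parity \<sigma> k t = parity1 \<sigma> k t + parity2 \<sigma> k (t - int T - int B)"

lemma not_dvd_small: "0 < \<bar>x\<bar> \<Longrightarrow> \<bar>x\<bar> \<le> int T \<Longrightarrow> \<not> p dvd x"
  using Tp zdvd_not_zless[of "\<bar>x\<bar>" p] by auto

text \<open>The unknowns fill an interval no longer than the number of equations. The nodes
  \<open>1 + j\<close> lie between 1 and \<open>T\<close>, so \<open>int T < p\<close> keeps them
  and their differences nonzero modulo \<open>p\<close>.\<close>

lemma solve_increasing:
  assumes "\<And>k. k0 \<le> k \<Longrightarrow> k < k0 + m \<Longrightarrow> p dvd (\<Sum>j\<in>{B..<T}. (1 + int j) ^ k * c j)"
    and "\<And>j. j \<in> {B..<T} \<Longrightarrow> j \<notin> {a..<b} \<Longrightarrow> p dvd c j" and "b - a \<le> m"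
    and "i \<in> {B..<T}"
  shows "p dvd c i"
proof (rule vandermonde_dvd[OF p _ _ _ assms(1) _ assms(4)])
  have "{j \<in> {B..<T}. \<not> p dvd c j} \<subseteq> {a..<b}"
    using assms(2) by blast
  from card_mono[OF _ this] show "card {j \<in> {B..<T}. \<not> p dvd c j} \<le> m"
    using assms(3) by simp
  show "\<not> p dvd 1 + int j" if "j \<in> {B..<T}" for j
    by (rule not_dvd_small) (use that in auto)
  show "\<not> p dvd (1 + int j) - (1 + int j')" if "j \<in> {B..<T}" "j' \<in> {B..<T}" "j \<noteq> j'" for j j'
    by (rule not_dvd_small) (use that in auto)
qed auto

lemma solve_decreasing:
  assumes "\<And>k. k0 \<le> k \<Longrightarrow> k < k0 + m \<Longrightarrow> p dvd (\<Sum>j\<in>{..<T - B}. (int T - int j) ^ k * c j)"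
    and "\<And>j. j < T - B \<Longrightarrow> j \<notin> {a..<b} \<Longrightarrow> p dvd c j" and "b - a \<le> m"
    and "i < T - B"
  shows "p dvd c i"
proof (rule vandermonde_dvd[OF p _ _ _ assms(1)])
  have "{j \<in> {..<T - B}. \<not> p dvd c j} \<subseteq> {a..<b}"
    using assms(2) by blast
  from card_mono[OF _ this] show "card {j \<in> {..<T - B}. \<not> p dvd c j} \<le> m"
    using assms(3) by simp
  show "\<not> p dvd int T - int j" if "j \<in> {..<T - B}" for j
    by (rule not_dvd_small) (use that in auto)
  show "\<not> p dvd (int T - int j) - (int T - int j')"
    if "j \<in> {..<T - B}" "j' \<in> {..<T - B}" "j \<noteq> j'" for j j'
    by (rule not_dvd_small) (use that in auto)
qed (use assms(4) in auto)

text \<open>Think of \<open>\<sigma>\<close> as the difference of two source streams, with the burst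
  at times 0 to \<open>B - 1\<close>. Non-urgent entries come first, one diagonal at a time, from
  parities whose urgent entry precedes the burst; each urgent entry is then the only unknown of the
  parity sent \<open>T\<close> steps later.\<close>

lemma recover_short_burst:
  assumes past: "\<And>j i. j < T \<Longrightarrow> i < 0 \<Longrightarrow> p dvd \<sigma> j i"
    and received: "\<And>j i. j < T \<Longrightarrow> int B \<le> i \<Longrightarrow> i \<le> i0 + int T \<Longrightarrow> p dvd \<sigma> j i"
    and eq: "\<And>k t. k < B \<Longrightarrow> int B \<le> t \<Longrightarrow> t \<le> i0 + int T \<Longrightarrow> p dvd parity1 \<sigma> k t"
    and i0: "0 \<le> i0" and "j0 < T"
  shows "p dvd \<sigma> j0 i0"
proof -
  have later: "p dvd \<sigma> j i" if j: "B \<le> j" "j < T" and "i \<le> i0 + int T" for j i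
  proof (cases "0 \<le> i \<and> i < int B")
    case True
    define d where "d = nat (int j - i)"
    have d: "int d = int j - i"
      using True j by (simp add: d_def)
    \<comment> \<open>On this diagonal parity \<open>k\<close> arrives at time
      \<open>T + k - d\<close>: after the burst if \<open>B + d - T \<le> k\<close>, and with its
      urgent entry in the past if \<open>k < d\<close>. The lost entries lie between
      \<open>d\<close> and \<open>d + B - 1\<close>, and there are as many non-urgent ones as usable
      parities.\<close>
    have "p dvd \<sigma> j (int j - int d)"
    proof (rule solve_increasing[where c = "\<lambda>j. \<sigma> j (int j - int d)" and ?k0.0 = "B + d - T"
          and m = "min B d - (B + d - T)" and a = "max B d" and b = "min T (d + B)"])
      fix k assume k: "B + d - T \<le> k" "k < B + d - T + (min B d - (B + d - T))"
      then have kd: "k < B" "k < d" "B + d \<le> T + k"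
        by auto
      have "p dvd parity1 \<sigma> k (int T + int k - int d)"
        by (rule eq) (use kd i0 in auto)
      moreover have "p dvd \<sigma> k (int k - int d)"
        by (rule past) (use kd BT in auto)
      ultimately show "p dvd (\<Sum>j\<in>{B..<T}. (1 + int j) ^ k * \<sigma> j (int j - int d))"
        by (simp add: parity1_def dvd_add_right_iff algebra_simps)
    next
      fix j' assume j': "j' \<in> {B..<T}" "j' \<notin> {max B d..<min T (d + B)}"
      then show "p dvd \<sigma> j' (int j' - int d)"
        using past[of j' "int j' - int d"] received[of j' "int j' - int d"] i0 by (cases "j' < d") auto
    qed (use j in auto)
    then show ?thesis
      using d by simp
  qed (use that past received in force)
  show ?thesis
  proof (cases "B \<le> j0")
    case True
    then show ?thesis
      using later \<open>j0 < T\<close> by simp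
  next
    case False
    have "p dvd parity1 \<sigma> j0 (i0 + int T)"
      by (rule eq) (use False i0 BT in auto)
    moreover have "p dvd (\<Sum>j\<in>{B..<T}. (1 + int j) ^ j0 * \<sigma> j (i0 - int j0 + int j))"
      by (intro dvd_sum dvd_mult later) auto
    ultimately show ?thesis
      by (simp add: parity1_def dvd_add_left_iff)
  qed
qed

lemma div_less_of_less_mult: "x < int \<beta> * m \<Longrightarrow> x div int \<beta> < m"
  using \<beta> by (smt (verit) int_div_less_self minus_mult_div_eq_mod mult_less_cancel_left_pos
      of_nat_1 of_nat_le_iff pos_mod_sign)

lemma le_div_of_mult_le: "int \<beta> * m \<le> x \<Longrightarrow> m \<le> x div int \<beta>"
  using \<beta> zdiv_mono1[of "int \<beta> * m" x "int \<beta>"] by simp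

text \<open>
  Induction on the level \<open>j + i div \<beta>\<close>, which is constant along the codewords of the second code
  and increases along those of the first. At each level the first code yields the symbols of the
  last \<open>B\<close> erased times, after which every codeword of the second code has at most as
  many unknowns left as parities.
\<close>

lemma recover_non_urgent:
  fixes n :: int
  assumes n: "int \<beta> * int T + int T + int B - 1 \<le> n"
    and past: "\<And>j i. j < T \<Longrightarrow> i < 0 \<Longrightarrow> p dvd \<sigma> j i"
    and received: "\<And>j i. j < T \<Longrightarrow> int \<beta> * int B + int B \<le> i \<Longrightarrow> i \<le> n \<Longrightarrow> p dvd \<sigma> j i"
    and eq: "\<And>k t. k < B \<Longrightarrow> int \<beta> * int B + int B \<le> t \<Longrightarrow> t \<le> n \<Longrightarrow> p dvd parity \<sigma> k t"
    and "j0 < T - B" "i0 \<le> n"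
  shows "p dvd \<sigma> j0 i0"
proof -
  have \<beta>0: "0 < int \<beta>"
    using \<beta> by simp
  have \<beta>BT: "int \<beta> * int B \<le> int \<beta> * int T"
    using BT by (intro mult_left_mono) auto
  have \<beta>B: "0 \<le> int \<beta> * int B"
    by simp
  have *: "\<forall>j i. j < T - B \<longrightarrow> i \<le> n \<longrightarrow> i < int \<beta> * int B + int B \<longrightarrow> 0 \<le> i \<longrightarrow>
    nat (int j + i div int \<beta>) = L \<longrightarrow> p dvd \<sigma> j i" for L
  proof (induction L rule: less_induct)
    case (less L)
    have lower: "p dvd \<sigma> j i" if "j < T - B" "i \<le> n" "int j + i div int \<beta> < int L" for j i
    proof (cases "0 \<le> i \<and> i < int \<beta> * int B + int B")
      case True
      then have "0 \<le> i div int \<beta>"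
        using \<beta>0 by (simp add: pos_imp_zdiv_nonneg_iff)
      then have "nat (int j + i div int \<beta>) < L"
        using that by linarith
      then show ?thesis
        using less.IH that True by blast
    next
      case False
      then show ?thesis
        using past[of j i] received[of j i] that by auto
    qed
    have last_block: "p dvd \<sigma> j i"
      if j: "j < T - B" and i: "int \<beta> * int B \<le> i" "i < int \<beta> * int B + int B"
        and L: "int j + i div int \<beta> = int L" for j i
    proof -
      have BL: "int j + int B \<le> int L"
        using le_div_of_mult_le[OF i(1)] L by simp
      \<comment> \<open>Parities on the first code's diagonal through entry \<open>j\<close> at time
        \<open>i\<close>. Their second summand reads only lower levels and the past, so they act as
        parities of the first code alone.\<close>
      have row: "p dvd \<sigma> k (i - int j + int k) +
          (\<Sum>j'\<in>{B..<T}. (1 + int j') ^ k * \<sigma> j' (i - int j + int j'))"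
        if k: "k \<le> j" "k < B" for k
      proof -
        have "p dvd \<sigma> j' (i - int j + int k - int B - int \<beta> * (int k + int j' + 1))"
          if j': "j' < T - B" for j'
        proof (rule lower[OF j'])
          have "i - int j + int k - int B - int \<beta> * (int k + int j' + 1) <
              int \<beta> * (int B - int k - int j' - 1)"
            using i k by (simp add: algebra_simps)
          from div_less_of_less_mult[OF this]
          show "int j' + (i - int j + int k - int B - int \<beta> * (int k + int j' + 1)) div int \<beta> < int L"
            using BL by linarith
          have "0 \<le> int \<beta> * (int k + int j' + 1)"
            by simp
          then show "i - int j + int k - int B - int \<beta> * (int k + int j' + 1) \<le> n"
            using i k n \<beta>BT by linarith
        qed
        moreover have "p dvd \<sigma> (T - 1 - k) (i - int j + int k - int B - int \<beta> * int T)"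
          by (rule past) (use k i \<beta>BT BT B in linarith)+
        ultimately have "p dvd parity2 \<sigma> k (i - int j + int k - int B)"
          unfolding parity2_def by (intro dvd_add dvd_sum dvd_mult) auto
        moreover have "p dvd parity \<sigma> k (i - int j + int T + int k)"
          by (rule eq) (use k i j n \<beta>BT in linarith)+
        ultimately have "p dvd parity1 \<sigma> k (i - int j + int T + int k)"
          by (simp add: parity_def dvd_add_left_iff algebra_simps)
        then show ?thesis
          by (simp add: parity1_def algebra_simps)
      qed
      have before: "p dvd \<sigma> k (i - int j + int k)" if "k < j" for k
      proof (rule lower)
        have "(i - int j + int k) div int \<beta> \<le> i div int \<beta>"
          using that \<beta>0 by (intro zdiv_mono1) auto
        then show "int k + (i - int j + int k) div int \<beta> < int L"
          using L that by linarith
      qed (use that j i n \<beta>BT in linarith)+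
      have after: "p dvd \<sigma> j' (i - int j + int j')" if "j + B \<le> j'" "j' < T" for j'
        by (rule received) (use that i n \<beta>BT in linarith)+
      show ?thesis
      \<comment> \<open>For \<open>j < B\<close> the entry is urgent in the first code: parities
        below \<open>j\<close> clear the at most \<open>j\<close> lost non-urgent entries, then
        parity \<open>j\<close> yields the entry. Otherwise the unknowns lie between
        \<open>j\<close> and \<open>j + B - 1\<close>, and all \<open>B\<close> parities are
        available.\<close>
      proof (cases "j < B")
        case True
        have "p dvd \<sigma> j' (i - int j + int j')" if "j' \<in> {B..<T}" for j'
        proof (rule solve_increasing[OF _ _ _ that, where ?k0.0 = 0 and m = j and a = B and b = "B + j"])
          fix k assume "k < 0 + j"
          then show "p dvd (\<Sum>j'\<in>{B..<T}. (1 + int j') ^ k * \<sigma> j' (i - int j + int j'))"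
            using row[of k] before[of k] True by (simp add: dvd_add_right_iff)
        qed (use after in auto)
        then have "p dvd (\<Sum>j'\<in>{B..<T}. (1 + int j') ^ j * \<sigma> j' (i - int j + int j'))"
          by (intro dvd_sum dvd_mult)
        then show ?thesis
          using row[of j] True by (simp add: dvd_add_left_iff)
      next
        case False
        have "p dvd \<sigma> j (i - int j + int j)"
        proof (rule solve_increasing[where c = "\<lambda>j'. \<sigma> j' (i - int j + int j')"
              and ?k0.0 = 0 and m = B and a = j and b = "j + B"])
          fix k assume "k < 0 + B"
          then show "p dvd (\<Sum>j'\<in>{B..<T}. (1 + int j') ^ k * \<sigma> j' (i - int j + int j'))"
            using row[of k] before[of k] False by (simp add: dvd_add_right_iff)
        qed (use before after False j in \<open>auto simp: not_le not_less\<close>)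
        then show ?thesis by simp
      qed
    qed
    have "p dvd \<sigma> j i" if j: "j < T - B" and i: "0 \<le> i" "i < int \<beta> * int B"
      and L: "int j + i div int \<beta> = int L" for j i
    proof -
      \<comment> \<open>The codeword of the second code through this symbol has entry
        \<open>j'\<close> at time \<open>e - \<beta> * j'\<close>, always at level
        \<open>L\<close>.\<close>
      define e where "e = i + int \<beta> * int j"
      have e: "e = int \<beta> * int L + i mod int \<beta>"
        by (simp add: e_def algebra_simps flip: L)
      have e_bounds: "int \<beta> * int L \<le> e" "e < int \<beta> * int L + int \<beta>"
        using \<beta>0 by (simp_all add: e)
      have LT: "L \<le> T - 2" "2 \<le> T"
        using div_less_of_less_mult[OF i(2)] L j B by linarith+
      \<comment> \<open>Parity \<open>k\<close> is usable if \<open>B \<le> L + k + 1\<close>, so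
        that its first summand reads only after the burst, and \<open>L + k + 2 \<le> T\<close>, so
        that its urgent entry precedes the burst and it arrives by time \<open>n\<close>. Entries
        above \<open>L\<close> precede the burst, and those up to \<open>L - B\<close> are received
        or come from \<open>last_block\<close>.\<close>
      have "p dvd \<sigma> j (e - int \<beta> * int j)"
      proof (rule solve_decreasing[where c = "\<lambda>j'. \<sigma> j' (e - int \<beta> * int j')"
            and ?k0.0 = "B - 1 - L" and m = "min B (T - 1 - L) - (B - 1 - L)"
            and a = "L + 1 - B" and b = "min (L + 1) (T - B)"])
        fix k assume "B - 1 - L \<le> k" "k < B - 1 - L + (min B (T - 1 - L) - (B - 1 - L))"
        then have k: "k < B" "B \<le> L + k + 1" "L + k + 2 \<le> T"
          using LT by auto
        define t where "t = e + int \<beta> * (int k + 1)"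
        have "int \<beta> * int B \<le> int \<beta> * (int L + int k + 1)"
          using k by (intro mult_left_mono) auto
        also have "\<dots> \<le> t"
          using e_bounds by (simp add: t_def algebra_simps)
        finally have t1: "int \<beta> * int B \<le> t" .
        have "int \<beta> * (int L + int k + 2) \<le> int \<beta> * int T"
          using k by (intro mult_left_mono) auto
        then have t2: "t < int \<beta> * int T"
          using e_bounds by (simp add: t_def algebra_simps)
        have "p dvd parity1 \<sigma> k (t + int T + int B)"
          unfolding parity1_def
          by (intro dvd_add dvd_sum dvd_mult received) (use k t1 t2 n BT in auto)
        moreover have "p dvd parity \<sigma> k (t + int T + int B)"
          by (rule eq) (use k t1 t2 n in auto)
        ultimately have "p dvd parity2 \<sigma> k t"
          by (simp add: parity_def dvd_add_right_iff)
        moreover have "p dvd \<sigma> (T - 1 - k) (t - int \<beta> * int T)"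
          by (rule past) (use t2 k B BT in auto)
        moreover have "t - int \<beta> * (int k + int j' + 1) = e - int \<beta> * int j'" for j'
          by (simp add: t_def algebra_simps)
        ultimately show "p dvd (\<Sum>j'\<in>{..<T - B}. (int T - int j') ^ k * \<sigma> j' (e - int \<beta> * int j'))"
          by (simp add: parity2_def dvd_add_right_iff)
      next
        fix j' assume j': "j' < T - B" "j' \<notin> {L + 1 - B..<min (L + 1) (T - B)}"
        show "p dvd \<sigma> j' (e - int \<beta> * int j')"
        proof (cases "L < j'")
          case True
          then have "int \<beta> * (int L + 1) \<le> int \<beta> * int j'"
            by (intro mult_left_mono) auto
          then show ?thesis
            using e_bounds j' by (intro past) (auto simp: algebra_simps)
        next
          case False
          then have "int \<beta> * int B \<le> int \<beta> * (int L - int j')"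
            using j' by (intro mult_left_mono) auto
          then have lo: "int \<beta> * int B \<le> e - int \<beta> * int j'"
            using e_bounds by (simp add: algebra_simps)
          have "e - int \<beta> * int j' = i mod int \<beta> + int \<beta> * (int L - int j')"
            by (simp add: e algebra_simps)
          then have div: "(e - int \<beta> * int j') div int \<beta> = int L - int j'"
            using \<beta>0 by simp
          have "int \<beta> * (int L + 1) \<le> int \<beta> * int T"
            using LT by (intro mult_left_mono) auto
          then have "e < int \<beta> * int T"
            using e_bounds by (simp add: algebra_simps)
          moreover have "0 \<le> int \<beta> * int j'"
            by simp
          ultimately have "e - int \<beta> * int j' \<le> n"
            using n by linarith
          then show ?thesis
            using last_block[OF j'(1) lo] received[of j' "e - int \<beta> * int j'"] div j'
            by (cases "e - int \<beta> * int j' < int \<beta> * int B + int B") auto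
        qed
      qed (use j LT B BT in \<open>auto simp: min_def\<close>)
      then show ?thesis
        by (simp add: e_def)
    qed
    then show ?case
      using last_block by (metis add_nonneg_nonneg int_nat_eq linorder_not_less of_nat_0_le_iff
          pos_imp_zdiv_nonneg_iff \<beta>0)
  qed
  show ?thesis
    using * past[of j0 i0] received[of j0 i0] assms(5,6)
    by (cases "0 \<le> i0 \<and> i0 < int \<beta> * int B + int B") auto
qed

text \<open>With the non-urgent entries known, an urgent entry is the only unknown of the parity
  sent \<open>\<beta> * T + T + B\<close> steps later, whose first summand lies entirely after the
  burst.\<close>

lemma recover_long_burst:
  assumes past: "\<And>j i. j < T \<Longrightarrow> i < 0 \<Longrightarrow> p dvd \<sigma> j i"
    and received: "\<And>j i. j < T \<Longrightarrow> int \<beta> * int B + int B \<le> i \<Longrightarrow>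
      i \<le> i0 + int \<beta> * int T + int T + int B \<Longrightarrow> p dvd \<sigma> j i"
    and eq: "\<And>k t. k < B \<Longrightarrow> int \<beta> * int B + int B \<le> t \<Longrightarrow>
      t \<le> i0 + int \<beta> * int T + int T + int B \<Longrightarrow> p dvd parity \<sigma> k t"
    and i0: "0 \<le> i0" and "j0 < T"
  shows "p dvd \<sigma> j0 i0"
proof -
  have \<beta>BT: "int \<beta> * int B \<le> int \<beta> * int T"
    using BT by (intro mult_left_mono) auto
  have \<beta>T: "0 \<le> int \<beta> * int T"
    by simp
  have non_urgent: "p dvd \<sigma> j i" if "j < T - B" "i \<le> i0 + int \<beta> * int T + int T + int B" for j i
    by (rule recover_non_urgent[OF _ past received eq that]) (use i0 in auto)
  show ?thesis
  proof (cases "j0 < T - B")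
    case True
    then show ?thesis
      using non_urgent \<beta>T i0 by simp
  next
    case False
    define k where "k = T - 1 - j0"
    have k: "k < B" "T - 1 - k = j0"
      using False \<open>j0 < T\<close> by (auto simp: k_def)
    let ?t = "i0 + int \<beta> * int T + int T + int B"
    have "p dvd parity \<sigma> k ?t"
      by (rule eq) (use k i0 \<beta>BT in auto)
    moreover have "p dvd parity1 \<sigma> k ?t"
      unfolding parity1_def
      by (intro dvd_add dvd_sum dvd_mult received) (use k i0 \<beta>BT BT in auto)
    ultimately have "p dvd parity2 \<sigma> k (i0 + int \<beta> * int T)"
      by (simp add: parity_def dvd_add_right_iff)
    moreover have "p dvd (\<Sum>j\<in>{..<T - B}. (int T - int j) ^ k *
        \<sigma> j (i0 + int \<beta> * int T - int \<beta> * (int k + int j + 1)))"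
    proof (intro dvd_sum dvd_mult non_urgent)
      fix j
      have "0 \<le> int \<beta> * (int k + int j + 1)"
        by simp
      then show "i0 + int \<beta> * int T - int \<beta> * (int k + int j + 1) \<le> i0 + int \<beta> * int T + int T + int B"
        by linarith
    qed simp
    ultimately show ?thesis
      using k by (simp add: parity2_def dvd_add_left_iff)
  qed
qed

end

section \<open>Prime fields on the natural numbers\<close>

text \<open>Representatives are natural numbers because the theorem asks for a code over
  \<open>nat\<close>.\<close>

definition residue_field :: "nat \<Rightarrow> nat ring" where
  "residue_field q = \<lparr>carrier = {0..<q}, mult = (\<lambda>a b. a * b mod q), one = 1,
     zero = 0, add = (\<lambda>a b. (a + b) mod q)\<rparr>"

lemma field_residue_field:
  assumes "prime q"
  shows "field (residue_field q)"
proof -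
  have q: "1 < q"
    using assms by (rule prime_gt_1_nat)
  interpret cring "residue_field q"
  proof (rule cringI)
    show "abelian_group (residue_field q)"
    proof (rule abelian_groupI)
      fix x assume "x \<in> carrier (residue_field q)"
      then show "\<exists>y\<in>carrier (residue_field q). y \<oplus>\<^bsub>residue_field q\<^esub> x = \<zero>\<^bsub>residue_field q\<^esub>"
        \<comment> \<open>The outer \<open>mod q\<close> matters at \<open>x = 0\<close>, where
          \<open>q - x\<close> leaves the carrier.\<close>
        using q by (intro bexI[of _ "(q - x) mod q"]) (auto simp: residue_field_def mod_add_left_eq)
    qed (use q in \<open>auto simp: residue_field_def mod_add_left_eq mod_add_right_eq ac_simps\<close>)
    show "comm_monoid (residue_field q)"
      by (rule comm_monoidI)
         (use q in \<open>auto simp: residue_field_def mod_mult_left_eq mod_mult_right_eq ac_simps\<close>)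
  qed (auto simp: residue_field_def mod_simps algebra_simps)
  show ?thesis
  proof (rule cring_fieldI2)
    fix a assume a: "a \<in> carrier (residue_field q)" "a \<noteq> \<zero>\<^bsub>residue_field q\<^esub>"
    then have "\<not> q dvd a"
      by (auto simp: residue_field_def dest: dvd_imp_le)
    then have "coprime a q"
      using assms prime_imp_coprime coprime_commute by blast
    then obtain b where "[a * b = Suc 0] (mod q)"
      using cong_solve_coprime_nat by blast
    then show "\<exists>b\<in>carrier (residue_field q). a \<otimes>\<^bsub>residue_field q\<^esub> b = \<one>\<^bsub>residue_field q\<^esub>"
      using q by (intro bexI[of _ "b mod q"]) (auto simp: residue_field_def cong_def mod_mult_right_eq)
  qed (simp add: residue_field_def)
qed

section \<open>The code and its rate\<close>

context multicast_parameters
begin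

text \<open>Padding by 0 before time 0 makes the first parities well defined. A parity at time
  \<open>t\<close> reads nothing beyond \<open>t\<close> (\<open>parity_cong\<close>), so the
  encoder's word suffices.\<close>

definition symbols :: "nat list list \<Rightarrow> nat \<Rightarrow> int \<Rightarrow> int" where
  "symbols w j i = (if i < 0 then 0 else int (w ! nat i ! j))"

definition codeword :: "nat \<Rightarrow> nat list list \<Rightarrow> nat list" where
  "codeword t w = w ! t @ map (\<lambda>k. nat (parity (symbols w) k (int t) mod p)) [0..<B]"

definition vectors :: "nat \<Rightarrow> nat list set" where
  "vectors l = {v. set v \<subseteq> {0..<nat p} \<and> length v = l}"

text \<open>\<open>to_nat\<close> packs a codeword into the type \<open>nat\<close>; being
  injective, it loses no information.\<close>

definition code :: "(nat, nat) streaming_code" where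
  "code = \<lparr>code_field = residue_field (nat p), source_dist = pmf_of_set (vectors T),
     channel_alphabet = to_nat ` vectors (T + B), encoder = (\<lambda>t w. to_nat (codeword t w))\<rparr>"

lemma p_gt_1: "1 < p"
  using p by (rule prime_gt_1_int)

lemma finite_vectors: "finite (vectors l)"
  unfolding vectors_def by (rule finite_lists_length_eq) simp

lemma card_vectors: "card (vectors l) = nat p ^ l"
  unfolding vectors_def using card_lists_length_eq[of "{0..<nat p}" l] by simp

lemma vectors_nonempty: "vectors l \<noteq> {}"
proof -
  have "replicate l 0 \<in> vectors l"
    using p_gt_1 by (auto simp: vectors_def)
  then show ?thesis by blast
qed

lemma source_alphabet_code: "source_alphabet T code = vectors T"
  by (simp add: source_alphabet_def code_def residue_field_def vectors_def)

sublocale source: iid_source T code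
  by unfold_locales
     (unfold source_alphabet_code, simp_all add: code_def finite_vectors vectors_nonempty)

lemma source_entropy_code: "source_entropy T code = T * log 2 p"
proof -
  have "source_entropy T code =
      - (\<Sum>x\<in>vectors T. 1 / real (nat p ^ T) * log 2 (1 / real (nat p ^ T)))"
    unfolding source_entropy_def source.entropy_coordinate source_alphabet_code
    by (auto simp: code_def vectors_nonempty finite_vectors card_vectors pmf_of_set indicator_def
        intro!: sum.cong)
  also have "\<dots> = log 2 (real_of_int p ^ T)"
    using p_gt_1 by (simp add: card_vectors log_divide)
  also have "\<dots> = T * log 2 p"
    using p_gt_1 by (simp add: log_nat_power)
  finally show ?thesis .
qed

lemma codeword_in_vectors:
  assumes "length w = Suc t" "set w \<subseteq> vectors T"
  shows "codeword t w \<in> vectors (T + B)"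
proof -
  have "w ! t \<in> vectors T"
    using assms nth_mem[of t w] by auto
  moreover have "nat (x mod p) < nat p" for x
    using p_gt_1 by (simp add: nat_less_eq_zless pos_mod_bound)
  ultimately show ?thesis
    by (auto simp: codeword_def vectors_def)
qed

lemma is_streaming_code_code: "is_streaming_code T code"
  unfolding is_streaming_code_def
proof (intro conjI allI impI)
  show "field (code_field code)"
    using p by (simp add: code_def field_residue_field)
  show "0 < source_entropy T code"
    using p_gt_1 B BT by (simp add: source_entropy_code)
  show "encoder code t w \<in> channel_alphabet code"
    if "length w = Suc t" "set w \<subseteq> source_alphabet T code" for t w
    using codeword_in_vectors[of w t] that by (simp add: source_alphabet_code) (simp add: code_def)
qed (use source.supp in \<open>auto simp: code_def residue_field_def finite_vectors\<close>)

section \<open>Reduction of feasibility to burst recovery\<close>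

lemma parity_cong:
  assumes "\<And>j i. i \<le> t \<Longrightarrow> \<sigma> j i = \<sigma>' j i"
  shows "parity \<sigma> k t = parity \<sigma>' k t"
proof -
  have "parity1 \<sigma> k t = parity1 \<sigma>' k t"
    unfolding parity1_def by (intro arg_cong2[of _ _ _ _ "(+)"] sum.cong) (auto intro: assms)
  moreover have "parity2 \<sigma> k (t - int T - int B) = parity2 \<sigma>' k (t - int T - int B)"
  proof -
    have "0 \<le> int \<beta> * x" if "0 \<le> x" for x
      using that by simp
    note nonneg = this[of "int T"] this[of "int k + int j + 1" for j]
    show ?thesis
      unfolding parity2_def
      by (intro arg_cong2[of _ _ _ _ "(+)"] sum.cong refl arg_cong2[of _ _ _ _ "(*)"] assms)
         (use nonneg in \<open>smt (verit) of_nat_0_le_iff\<close>)+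
  qed
  ultimately show ?thesis
    by (simp add: parity_def)
qed

text \<open>Linearity here and shift invariance below replace two source sequences and a burst at
  any time by one difference sequence with its burst at time 0.\<close>

lemma parity_diff: "parity (\<lambda>j i. \<sigma> j i - \<sigma>' j i) k t = parity \<sigma> k t - parity \<sigma>' k t"
  by (simp add: parity_def parity1_def parity2_def sum_subtractf right_diff_distrib)

lemma parity_shift: "parity (\<lambda>j i. \<sigma> j (a + i)) k t = parity \<sigma> k (a + t)"
  by (simp add: parity_def parity1_def parity2_def algebra_simps)

definition stream :: "(nat \<Rightarrow> nat list) \<Rightarrow> nat \<Rightarrow> int \<Rightarrow> int" where
  "stream \<omega> j i = (if i < 0 then 0 else int (\<omega> (nat i) ! j))"

lemma channel_symbol_eqD:
  assumes "channel_symbol code t \<omega> = channel_symbol code t \<omega>'"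
    and "\<omega> \<in> space (source_space T code)" "\<omega>' \<in> space (source_space T code)"
  shows "\<omega> t = \<omega>' t"
    and "k < B \<Longrightarrow> p dvd parity (stream \<omega>) k (int t) - parity (stream \<omega>') k (int t)"
proof -
  have len: "length (\<omega> t) = T" "length (\<omega>' t) = T"
    using assms(2,3) by (auto simp: space_source_space source_alphabet_code vectors_def)
  have "codeword t (map \<omega> [0..<Suc t]) = codeword t (map \<omega>' [0..<Suc t])"
    using assms(1) by (simp add: channel_symbol_def code_def)
  \<comment> \<open>Source vectors all have length \<open>T\<close>, so equal codewords split into
    equal vectors and equal parities.\<close>
  then have eq: "\<omega> t = \<omega>' t"
      "map (\<lambda>k. nat (parity (symbols (map \<omega> [0..<Suc t])) k (int t) mod p)) [0..<B] =
       map (\<lambda>k. nat (parity (symbols (map \<omega>' [0..<Suc t])) k (int t) mod p)) [0..<B]"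
    using len unfolding codeword_def by (simp_all add: nth_append del: upt_Suc map_eq_conv)
  then show "\<omega> t = \<omega>' t"
    by simp
  have "parity (symbols (map \<omega> [0..<Suc t])) k (int t) = parity (stream \<omega>) k (int t)" for \<omega> k
    by (rule parity_cong) (auto simp: symbols_def stream_def simp del: upt_Suc)
  then have "nat (parity (stream \<omega>) k (int t) mod p) = nat (parity (stream \<omega>') k (int t) mod p)"
    if "k < B" for k
    using eq(2) that by simp
  then show "p dvd parity (stream \<omega>) k (int t) - parity (stream \<omega>') k (int t)" if "k < B"
    using that p_gt_1 by (simp add: mod_eq_dvd_iff eq_nat_nat_iff)
qed

lemma separated_code:
  assumes recover: "\<And>\<sigma> i0 j. 0 \<le> i0 \<Longrightarrow> i0 < int b \<Longrightarrow>
      (\<And>j i. j < T \<Longrightarrow> i < 0 \<Longrightarrow> p dvd \<sigma> j i) \<Longrightarrow>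
      (\<And>j i. j < T \<Longrightarrow> int b \<le> i \<Longrightarrow> i \<le> i0 + int d \<Longrightarrow> p dvd \<sigma> j i) \<Longrightarrow>
      (\<And>k t. k < B \<Longrightarrow> int b \<le> t \<Longrightarrow> t \<le> i0 + int d \<Longrightarrow> p dvd parity \<sigma> k t) \<Longrightarrow>
      j < T \<Longrightarrow> p dvd \<sigma> j i0"
  shows "separated code b d (space (source_space T code))"
  unfolding separated_def
proof (intro ballI allI impI)
  fix \<omega> \<omega>' j0 t0
  assume \<omega>: "\<omega> \<in> space (source_space T code)" "\<omega>' \<in> space (source_space T code)"
    and eq: "\<forall>k \<le> t0 + d. k < j0 \<or> j0 + b \<le> k \<longrightarrow> channel_symbol code k \<omega> = channel_symbol code k \<omega>'"
  show "\<omega> t0 = \<omega>' t0"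
  proof (cases "j0 \<le> t0 \<and> t0 < j0 + b")
    \<comment> \<open>A source vector outside the burst is received uncoded.\<close>
    case False
    then show ?thesis
      using eq channel_symbol_eqD(1)[OF _ \<omega>] by auto
  next
    case True
    define \<sigma> where "\<sigma> j i = stream \<omega> j (int j0 + i) - stream \<omega>' j (int j0 + i)" for j i
    have \<sigma>_received: "\<sigma> j i = 0" if "i < 0 \<or> int b \<le> i" "i \<le> int t0 - int j0 + int d" for j i
    proof (cases "int j0 + i < 0")
      case False
      then have "nat (int j0 + i) \<le> t0 + d" "nat (int j0 + i) < j0 \<or> j0 + b \<le> nat (int j0 + i)"
        using that by auto
      then have "\<omega> (nat (int j0 + i)) = \<omega>' (nat (int j0 + i))"
        using eq channel_symbol_eqD(1)[OF _ \<omega>] by blast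
      then show ?thesis
        by (simp add: \<sigma>_def stream_def)
    qed (simp add: \<sigma>_def stream_def)
    have \<sigma>_parity: "p dvd parity \<sigma> k t" if "k < B" "int b \<le> t" "t \<le> int t0 - int j0 + int d" for k t
    proof -
      define t' where "t' = nat (int j0 + t)"
      have t': "int t' = int j0 + t" "t' \<le> t0 + d" "j0 + b \<le> t'"
        using that by (auto simp: t'_def)
      have "parity \<sigma> k t = parity (stream \<omega>) k (int t') - parity (stream \<omega>') k (int t')"
        unfolding \<sigma>_def parity_diff parity_shift t'(1) ..
      then show ?thesis
        using channel_symbol_eqD(2)[OF _ \<omega> \<open>k < B\<close>, of t'] eq t' by simp
    qed
    have "\<omega> t0 ! j = \<omega>' t0 ! j" if j: "j < T" for j
    proof -
      have "p dvd \<sigma> j (int t0 - int j0)"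
        by (rule recover) (use True j \<sigma>_received \<sigma>_parity in auto)
      then have "p dvd int (\<omega> t0 ! j) - int (\<omega>' t0 ! j)"
        by (simp add: \<sigma>_def stream_def)
      \<comment> \<open>Both entries are residues below \<open>p\<close>, so congruence is
        equality.\<close>
      moreover have "int (\<omega> t0 ! j) < p" "int (\<omega>' t0 ! j) < p"
      proof -
        have "set (\<omega> t0) \<subseteq> {0..<nat p}" "set (\<omega>' t0) \<subseteq> {0..<nat p}" "length (\<omega> t0) = T" "length (\<omega>' t0) = T"
          using \<omega> by (auto simp: space_source_space source_alphabet_code vectors_def)
        then have "\<omega> t0 ! j < nat p" "\<omega>' t0 ! j < nat p"
          using j nth_mem by (metis atLeastLessThan_iff subsetD)+
        then show "int (\<omega> t0 ! j) < p" "int (\<omega>' t0 ! j) < p"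
          by linarith+
      qed
      ultimately show ?thesis
        by (simp flip: mod_eq_dvd_iff)
    qed
    moreover have "length (\<omega> t0) = T" "length (\<omega>' t0) = T"
      using \<omega> by (auto simp: space_source_space source_alphabet_code vectors_def)
    ultimately show ?thesis
      by (simp add: list_eq_iff_nth_eq)
  qed
qed

text \<open>Up to time \<open>i0 + T\<close> with \<open>i0 < B\<close>, the delayed second summand
  reads only times before the burst. It vanishes modulo \<open>p\<close>, leaving the first code
  alone.\<close>

lemma separated_code_short: "separated code B T (space (source_space T code))"
proof (rule separated_code)
  fix \<sigma> :: "nat \<Rightarrow> int \<Rightarrow> int" and i0 j
  assume i0: "0 \<le> i0" "i0 < int B"
    and past: "\<And>j i. j < T \<Longrightarrow> i < 0 \<Longrightarrow> p dvd \<sigma> j i"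
    and received: "\<And>j i. j < T \<Longrightarrow> int B \<le> i \<Longrightarrow> i \<le> i0 + int T \<Longrightarrow> p dvd \<sigma> j i"
    and eq: "\<And>k t. k < B \<Longrightarrow> int B \<le> t \<Longrightarrow> t \<le> i0 + int T \<Longrightarrow> p dvd parity \<sigma> k t"
    and "j < T"
  show "p dvd \<sigma> j i0"
  proof (rule recover_short_burst[OF past received _ i0(1) \<open>j < T\<close>])
    fix k t assume k: "k < B" and t: "int B \<le> t" "t \<le> i0 + int T"
    have "p dvd \<sigma> j (t - int T - int B - int \<beta> * x)" if "j < T" "0 \<le> x" for j x
    proof (rule past[OF \<open>j < T\<close>])
      have "0 \<le> int \<beta> * x"
        using that by simp
      then show "t - int T - int B - int \<beta> * x < 0"
        using t i0 by linarith
    qed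
    then have "p dvd parity2 \<sigma> k (t - int T - int B)"
      unfolding parity2_def by (intro dvd_add dvd_sum dvd_mult) (use B BT in auto)
    then show "p dvd parity1 \<sigma> k t"
      using eq[OF k t] by (simp add: parity_def dvd_add_left_iff)
  qed
qed

lemma separated_code_long:
  "separated code (Suc \<beta> * B) (Suc \<beta> * T + B) (space (source_space T code))"
proof (rule separated_code)
  have eqs: "int (Suc \<beta> * B) = int \<beta> * int B + int B"
    "i0 + int (Suc \<beta> * T + B) = i0 + int \<beta> * int T + int T + int B" for i0
    by (simp_all add: algebra_simps)
  show "p dvd \<sigma> j i0"
    if "0 \<le> i0" "i0 < int (Suc \<beta> * B)"
      and "\<And>j i. j < T \<Longrightarrow> i < 0 \<Longrightarrow> p dvd \<sigma> j i"
      and "\<And>j i. j < T \<Longrightarrow> int (Suc \<beta> * B) \<le> i \<Longrightarrow> i \<le> i0 + int (Suc \<beta> * T + B) \<Longrightarrow> p dvd \<sigma> j i"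
      and "\<And>k t. k < B \<Longrightarrow> int (Suc \<beta> * B) \<le> t \<Longrightarrow> t \<le> i0 + int (Suc \<beta> * T + B) \<Longrightarrow> p dvd parity \<sigma> k t"
      and "j < T" for \<sigma> i0 j
    by (rule recover_long_burst[OF that(3,4,5,1,6)[unfolded eqs]])
qed

lemma feasible_code: "feasible T code {(B, T), (Suc \<beta> * B, Suc \<beta> * T + B)}"
proof (rule feasible_if_separated)
  fix b d assume "(b, d) \<in> {(B, T), (Suc \<beta> * B, Suc \<beta> * T + B)}"
  then consider "b = B" "d = T" | "b = Suc \<beta> * B" "d = Suc \<beta> * T + B"
    by blast
  then show "separated code b d (space (source_space T code))"
    by cases (use separated_code_short separated_code_long in \<open>simp_all only:\<close>)
qed

lemma rate_code: "rate T code = real T / real (T + B)"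
proof -
  interpret streaming_source T code
    by unfold_locales (rule is_streaming_code_code)
  have "0 < log 2 p"
    using p_gt_1 by simp
  have "card (channel_alphabet code) = nat p ^ (T + B)"
    by (simp add: code_def card_image inj_on_def card_vectors)
  \<comment> \<open>Upper bound from the size of the alphabet. The matching lower bound is the
    converse for the first receiver, which avoids computing the distribution of the
    parities.\<close>
  then have "rv_entropy (source_space T code) (channel_symbol code t) \<le> (T + B) * log 2 p" for t
    using channel_entropy_bound[of t] p_gt_1 by (simp add: log_nat_power)
  then have "channel_entropy T code \<le> (T + B) * log 2 p"
    unfolding channel_entropy_def by (intro cSUP_least) auto
  moreover have "(B + T) * (T * log 2 p) \<le> T * channel_entropy T code"
    using entropy_bound_single[OF feasible_code, of B T] B BT by (simp add: source_entropy_code)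
  then have "T * ((T + B) * log 2 p) \<le> T * channel_entropy T code"
    by (simp add: algebra_simps)
  then have "(T + B) * log 2 p \<le> channel_entropy T code"
    using B BT by (simp only: mult_le_cancel_left_pos of_nat_0_less_iff)
  ultimately have "channel_entropy T code = (T + B) * log 2 p"
    by (rule antisym)
  then show ?thesis
    using \<open>0 < log 2 p\<close> by (simp add: rate_def source_entropy_code)
qed

end

theorem theorem1:
  fixes B T \<alpha> :: nat
  assumes "1 \<le> B" and "B \<le> T" and "2 \<le> \<alpha>"
  shows
    "(\<forall>(C :: ('q, 'x) streaming_code) T2.
        is_streaming_code T C \<longrightarrow> rate T C = real T / real (T + B) \<longrightarrow>
        feasible T C {(B, T), (\<alpha> * B, T2)} \<longrightarrow> \<alpha> * T + B \<le> T2) \<and>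
     (\<exists>C :: (nat, nat) streaming_code.
        is_streaming_code T C \<and> rate T C = real T / real (T + B) \<and>
        feasible T C {(B, T), (\<alpha> * B, \<alpha> * T + B)})"
proof (intro conjI allI impI)
  fix C :: "('q, 'x) streaming_code" and T2
  assume "is_streaming_code T C" and rate: "rate T C = real T / real (T + B)"
    and feasible: "feasible T C {(B, T), (\<alpha> * B, T2)}"
  then interpret streaming_source T C
    by unfold_locales
  show "\<alpha> * T + B \<le> T2"
    by (rule delay_lower_bound[OF feasible _ _ assms(1) _ assms(3) rate]) (use assms in auto)
next
  obtain q :: nat where "prime q" "T < q"
    using bigger_prime by blast
  then interpret multicast_parameters B T "\<alpha> - 1" "int q"
    using assms by unfold_locales auto
  have "Suc (\<alpha> - 1) = \<alpha>"
    using assms by simp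
  then show "\<exists>C :: (nat, nat) streaming_code.
      is_streaming_code T C \<and> rate T C = real T / real (T + B) \<and>
      feasible T C {(B, T), (\<alpha> * B, \<alpha> * T + B)}"
    using is_streaming_code_code rate_code feasible_code by auto
qed

end
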